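(* Let $(X,\mathscr{E})$ be a coarse space with fixed basepoint $x_0\in X$. If $X$ has coarse property C, then the coarse free product $(\ast X,\ast\mathscr{E})$ has coarse property C.
   Context: Coarse spaces. For $E,F\subset X\times X$ put $E\circ F=\{(x,z): \exists y,\ (x,y)\in E,\ (y,z)\in F\}$, $E^{-1}=\{(y,x):(x,y)\in E\}$, and let $\Delta$ be the diagonal. A coarse structure on $X$ is a collection $\mathscr{E}$ of subsets of $X\times X$ (called entourages) containing $\Delta$ and closed under inverses, finite unions, subsets and compositions; $(X,\mathscr{E})$ is then a coarse space. A family $\mathcal{U}$ of subsets of $X$ is $E$-disjoint if $(U\times U')\cap E=\emptyset$ for distinct $U,U'\in\mathcal{U}$, and bounded if $\bigcup_{U\in\mathcal{U}}U\times U\subset K$ for some $K\in\mathscr{E}$. Coarse property C. $(X,\mathscr{E})$ has coarse property C if for every sequence $E_1\subset E_2\subset\cdots$ of entourages there is a finite sequence $\mathcal{U}_1,\dots,\mathcal{U}_n$ of families of subsets of $X$ such that $\bigcup_{i=1}^n\mathcal{U}_i$ covers $X$, each $\mathcal{U}_i$ is $E_i$-disjoint, and each $\mathcal{U}_i$ is bounded. Coarse free product. $\ast X$ is the set of finite words in the alphabet $X\setminus\{x_0\}$, including the empty word $\boldsymbol{\epsilon}$, which is identified with $x_0$. For $E\in\mathscr{E}$ let $E^k$ be the $k$-fold composition ($k\ge1$), $E^0=E\cap\Delta$, and $D_E(x,y)=\min\{k\ge 0:(x,y)\in E^k\}\in\mathbb{Z}_{\ge0}\cup\{+\infty\}$ ($\min\emptyset=+\infty$).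 For $\mathbf{x}=x_1\cdots x_k\in\ast X$ put $\|\mathbf{x}\|_E=\sum_i D_E(x_0,x_i)$, $\|\mathbf{x}\|^E=\sum_i D_E(x_i,x_0)$, and $\|\boldsymbol{\epsilon}\|_E=\|\boldsymbol{\epsilon}\|^E=0$. Distinct words are written uniquely as $\mathbf{x}=\mathbf{a}b\mathbf{c}$, $\mathbf{x}'=\mathbf{a}b'\mathbf{c}'$, where $\mathbf{a}$ is their longest common prefix and $b\ne b'$ are the next letters (if $\mathbf{x}=\mathbf{a}$ then $b=x_0$, $\mathbf{c}=\boldsymbol{\epsilon}$; similarly for $\mathbf{x}'$). Put $D^*_E(\mathbf{x},\mathbf{x})=0$ and $D_E^*(\mathbf{x},\mathbf{x}')=D_E(b,b')+\|\mathbf{c}\|_E+\|\mathbf{c}'\|^E$ for $\mathbf{x}\ne\mathbf{x}'$. Let $\langle E,n\rangle=\{(\mathbf{x},\mathbf{x}'): D_E^*(\mathbf{x},\mathbf{x}')\le n\}$. The coarse structure $\ast\mathscr{E}$ consists of all subsets of the sets $\langle E,n\rangle$, $E\in\mathscr{E}$, $n\in\mathbb{N}$. *)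

theory Defs
  imports Main "HOL-Library.Extended_Nat" "HOL-Library.Sublist"
begin

locale coarse_space =
  fixes X :: "'a set" and \<E> :: "('a \<times> 'a) set set"
  assumes entourage_subset: "E \<in> \<E> \<Longrightarrow> E \<subseteq> X \<times> X"
    and diagonal: "Id_on X \<in> \<E>"
    and converse: "E \<in> \<E> \<Longrightarrow> E\<inverse> \<in> \<E>"
    and union: "E \<in> \<E> \<Longrightarrow> F \<in> \<E> \<Longrightarrow> E \<union> F \<in> \<E>"
    and subset: "E \<in> \<E> \<Longrightarrow> F \<subseteq> E \<Longrightarrow> F \<in> \<E>"
    and comp: "E \<in> \<E> \<Longrightarrow> F \<in> \<E> \<Longrightarrow> E O F \<in> \<E>"

definition coarse_disjoint :: "('a \<times> 'a) set \<Rightarrow> 'a set set \<Rightarrow> bool" where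
  "coarse_disjoint E \<U> \<longleftrightarrow> (\<forall>U\<in>\<U>. \<forall>V\<in>\<U>. U \<noteq> V \<longrightarrow> (U \<times> V) \<inter> E = {})"

definition coarse_bounded :: "('a \<times> 'a) set set \<Rightarrow> 'a set set \<Rightarrow> bool" where
  "coarse_bounded \<E> \<U> \<longleftrightarrow> (\<exists>K\<in>\<E>. (\<Union>U\<in>\<U>. U \<times> U) \<subseteq> K)"

(* Sequences are indexed from 0. *)
definition coarse_property_C :: "'a set \<Rightarrow> ('a \<times> 'a) set set \<Rightarrow> bool" where
  "coarse_property_C X \<E> \<longleftrightarrow>
     (\<forall>E :: nat \<Rightarrow> ('a \<times> 'a) set. (\<forall>i. E i \<in> \<E>) \<and> (\<forall>i. E i \<subseteq> E (Suc i)) \<longrightarrow>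
       (\<exists>n. \<exists>\<U> :: nat \<Rightarrow> 'a set set.
          (\<forall>i<n. \<U> i \<subseteq> Pow X) \<and>
          \<Union> (\<Union>i<n. \<U> i) = X \<and>
          (\<forall>i<n. coarse_disjoint (E i) (\<U> i)) \<and>
          (\<forall>i<n. coarse_bounded \<E> (\<U> i))))"

(* Differs from relpow at exponent 0, where relpow gives the full diagonal
   whereas here only the part of the diagonal lying in E is taken. *)
definition ent_pow :: "('a \<times> 'a) set \<Rightarrow> nat \<Rightarrow> ('a \<times> 'a) set" where
  "ent_pow E k = (if k = 0 then E \<inter> Id else E ^^ k)"

(* The infimum of the empty set is infinity in enat; otherwise it is a minimum. *)
definition ent_dist :: "('a \<times> 'a) set \<Rightarrow> 'a \<Rightarrow> 'a \<Rightarrow> enat" where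
  "ent_dist E x y = (INF k\<in>{k. (x, y) \<in> ent_pow E k}. enat k)"

(* Words over X - {x0}; the empty word [] plays the role of x0. *)
definition free_words :: "'a set \<Rightarrow> 'a \<Rightarrow> 'a list set" where
  "free_words X x\<^sub>0 = lists (X - {x\<^sub>0})"

definition word_norm_from :: "('a \<times> 'a) set \<Rightarrow> 'a \<Rightarrow> 'a list \<Rightarrow> enat" where
  "word_norm_from E x\<^sub>0 w = (\<Sum>x\<leftarrow>w. ent_dist E x\<^sub>0 x)"

definition word_norm_to :: "('a \<times> 'a) set \<Rightarrow> 'a \<Rightarrow> 'a list \<Rightarrow> enat" where
  "word_norm_to E x\<^sub>0 w = (\<Sum>x\<leftarrow>w. ent_dist E x x\<^sub>0)"

definition first_letter :: "'a \<Rightarrow> 'a list \<Rightarrow> 'a" where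
  "first_letter x\<^sub>0 w = (case w of [] \<Rightarrow> x\<^sub>0 | b # _ \<Rightarrow> b)"

(* After removing the longest common prefix, the remaining words r and r' are b c and b' c';
   if r is empty, then b = x0 by first_letter and c = [] because tl [] = []. *)
definition free_dist :: "('a \<times> 'a) set \<Rightarrow> 'a \<Rightarrow> 'a list \<Rightarrow> 'a list \<Rightarrow> enat" where
  "free_dist E x\<^sub>0 w w' =
     (if w = w' then 0
      else let a = Longest_common_prefix {w, w'};
               r = drop (length a) w;
               r' = drop (length a) w'
           in ent_dist E (first_letter x\<^sub>0 r) (first_letter x\<^sub>0 r')
              + word_norm_from E x\<^sub>0 (tl r) + word_norm_to E x\<^sub>0 (tl r'))"

definition free_ball :: "'a set \<Rightarrow> 'a \<Rightarrow> ('a \<times> 'a) set \<Rightarrow> nat \<Rightarrow> ('a list \<times> 'a list) set" where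
  "free_ball X x\<^sub>0 E n =
     {(w, w'). w \<in> free_words X x\<^sub>0 \<and> w' \<in> free_words X x\<^sub>0 \<and> free_dist E x\<^sub>0 w w' \<le> enat n}"

definition free_coarse :: "'a set \<Rightarrow> ('a \<times> 'a) set set \<Rightarrow> 'a \<Rightarrow> ('a list \<times> 'a list) set set" where
  "free_coarse X \<E> x\<^sub>0 = {F. \<exists>E\<in>\<E>. \<exists>n. F \<subseteq> free_ball X x\<^sub>0 E n}"

lemma ent_dist_le_iff: "ent_dist E x y \<le> enat n \<longleftrightarrow> (\<exists>k\<le>n. (x, y) \<in> ent_pow E k)"
proof
  assume le: "ent_dist E x y \<le> enat n"
  let ?A = "enat ` {k. (x, y) \<in> ent_pow E k}"
  have ne: "?A \<noteq> {}" using le by (cases "?A = {}") (simp_all add: ent_dist_def Inf_enat_def)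
  then obtain a where "a \<in> ?A" by blast
  then have "Inf ?A \<in> ?A" using ne by (simp only: Inf_enat_def if_False) (rule LeastI)
  then show "\<exists>k\<le>n. (x, y) \<in> ent_pow E k" using le by (auto simp: ent_dist_def)
next
  assume "\<exists>k\<le>n. (x, y) \<in> ent_pow E k"
  then show "ent_dist E x y \<le> enat n"
    unfolding ent_dist_def by (meson INF_lower2 enat_ord_simps(1) mem_Collect_eq)
qed

lemma ent_dist_leI:
  assumes "\<And>n. a \<le> enat n \<Longrightarrow> ent_dist E x y \<le> enat n"
  shows "ent_dist E x y \<le> a"
  using assms by (cases a) auto

lemma ent_pow_mono:
  assumes "E \<subseteq> F"
  shows "ent_pow E k \<subseteq> ent_pow F k"
proof -
  have "E ^^ k \<subseteq> F ^^ k"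
    by (induction k) (use assms in auto)
  then show ?thesis using assms by (auto simp: ent_pow_def)
qed

lemma ent_dist_mono: "E \<subseteq> F \<Longrightarrow> ent_dist F x y \<le> ent_dist E x y"
  by (rule ent_dist_leI) (meson ent_dist_le_iff ent_pow_mono subsetD)

lemma ent_pow_converse: "(x, y) \<in> ent_pow (E\<inverse>) k \<longleftrightarrow> (y, x) \<in> ent_pow E k"
proof -
  have "(E\<inverse>) ^^ k = (E ^^ k)\<inverse>"
  proof (induction k)
    case (Suc k)
    then show ?case by (simp add: converse_relcomp relpow_commute[symmetric])
  qed simp
  then show ?thesis by (auto simp: ent_pow_def)
qed

lemma ent_dist_converse: "ent_dist (E\<inverse>) x y = ent_dist E y x"
  by (simp add: ent_dist_def ent_pow_converse)

lemma ent_dist_triangle: "ent_dist E x z \<le> ent_dist E x y + ent_dist E y z"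
proof (cases "ent_dist E x y"; cases "ent_dist E y z")
  fix m n assume "ent_dist E x y = enat m" "ent_dist E y z = enat n"
  then obtain k l where kl: "k \<le> m" "l \<le> n" "(x, y) \<in> ent_pow E k" "(y, z) \<in> ent_pow E l"
    by (metis ent_dist_le_iff order_refl)
  have "(x, z) \<in> ent_pow E (k + l)"
    using kl(3,4) by (auto simp: ent_pow_def relpow_add split: if_splits)
  then show ?thesis
    using kl \<open>ent_dist E x y = enat m\<close> \<open>ent_dist E y z = enat n\<close>
    by (auto simp: ent_dist_le_iff intro!: exI[of _ "k + l"])
qed auto

lemma free_dist_same [simp]: "free_dist E x\<^sub>0 w w = 0"
  by (simp add: free_dist_def)

lemma free_dist_Nil_Cons [simp]:
  "free_dist E x\<^sub>0 [] (y # ys) = ent_dist E x\<^sub>0 y + word_norm_to E x\<^sub>0 ys"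
  by (simp add: free_dist_def Longest_common_prefix_Nil first_letter_def word_norm_from_def)

lemma free_dist_Cons_Nil [simp]:
  "free_dist E x\<^sub>0 (x # xs) [] = ent_dist E x x\<^sub>0 + word_norm_from E x\<^sub>0 xs"
  by (simp add: free_dist_def Longest_common_prefix_Nil first_letter_def word_norm_to_def)

lemma free_dist_Cons_Cons [simp]:
  "free_dist E x\<^sub>0 (x # xs) (y # ys) =
    (if x = y then free_dist E x\<^sub>0 xs ys
     else ent_dist E x y + word_norm_from E x\<^sub>0 xs + word_norm_to E x\<^sub>0 ys)"
proof (cases "x = y")
  case True
  have "Longest_common_prefix {x # xs, x # ys} = x # Longest_common_prefix {xs, ys}"
    using Longest_common_prefix_image_Cons[of "{xs, ys}" x] by simp
  then show ?thesis using True by (auto simp: free_dist_def Let_def)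
next
  case False
  have "Longest_common_prefix {x # xs, y # ys} = []"
    using Longest_common_prefix_prefix[of "x # xs" "{x # xs, y # ys}"]
      Longest_common_prefix_prefix[of "y # ys" "{x # xs, y # ys}"] False
    by (cases "Longest_common_prefix {x # xs, y # ys}") auto
  then show ?thesis using False by (simp add: free_dist_def first_letter_def)
qed

lemma word_norm_simps [simp]:
  "word_norm_from E x\<^sub>0 [] = 0" "word_norm_to E x\<^sub>0 [] = 0"
  "word_norm_from E x\<^sub>0 (x # xs) = ent_dist E x\<^sub>0 x + word_norm_from E x\<^sub>0 xs"
  "word_norm_to E x\<^sub>0 (x # xs) = ent_dist E x x\<^sub>0 + word_norm_to E x\<^sub>0 xs"
  by (simp_all add: word_norm_from_def word_norm_to_def)

lemma word_norm_mono:
  assumes "E \<subseteq> F"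
  shows "word_norm_from F x\<^sub>0 w \<le> word_norm_from E x\<^sub>0 w" "word_norm_to F x\<^sub>0 w \<le> word_norm_to E x\<^sub>0 w"
  using assms by (induction w) (auto intro: add_mono ent_dist_mono)

lemma free_dist_mono: "E \<subseteq> F \<Longrightarrow> free_dist F x\<^sub>0 w w' \<le> free_dist E x\<^sub>0 w w'"
  by (auto simp: free_dist_def Let_def intro!: add_mono ent_dist_mono word_norm_mono)

lemma word_norm_converse:
  "word_norm_from (E\<inverse>) x\<^sub>0 w = word_norm_to E x\<^sub>0 w" "word_norm_to (E\<inverse>) x\<^sub>0 w = word_norm_from E x\<^sub>0 w"
  by (induction w) (auto simp: ent_dist_converse)

lemma free_dist_converse: "free_dist (E\<inverse>) x\<^sub>0 w w' = free_dist E x\<^sub>0 w' w"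
  by (auto simp: free_dist_def Let_def ent_dist_converse word_norm_converse insert_commute add_ac)

context
  fixes G :: "('a \<times> 'a) set" and x\<^sub>0 :: 'a
  assumes sym: "G\<inverse> = G"
begin

lemma sym_ent_dist: "ent_dist G x y = ent_dist G y x"
  using ent_dist_converse[of G] by (simp add: sym)

lemma sym_word_norm: "word_norm_to G x\<^sub>0 w = word_norm_from G x\<^sub>0 w"
  using word_norm_converse[of G] by (simp add: sym)

lemma sym_free_dist: "free_dist G x\<^sub>0 w w' = free_dist G x\<^sub>0 w' w"
  using free_dist_converse[of G] by (simp add: sym)

lemma free_dist_Nil: "free_dist G x\<^sub>0 [] w = word_norm_from G x\<^sub>0 w"
  by (cases w) (auto simp: sym_word_norm)

lemma word_norm_le: "word_norm_from G x\<^sub>0 u \<le> word_norm_from G x\<^sub>0 v + free_dist G x\<^sub>0 v u"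
proof (induction u arbitrary: v)
  case (Cons x xs)
  show ?case
  proof (cases v)
    case Nil
    then show ?thesis by (simp add: sym_word_norm)
  next
    case v: (Cons y ys)
    show ?thesis
    proof (cases "x = y")
      case True
      then show ?thesis using Cons[of ys] v by (simp add: add.assoc add_left_mono)
    next
      case False
      have "ent_dist G x\<^sub>0 x + word_norm_from G x\<^sub>0 xs
          \<le> (ent_dist G x\<^sub>0 y + ent_dist G y x) + word_norm_from G x\<^sub>0 xs"
        by (intro add_mono ent_dist_triangle order_refl)
      also have "\<dots> \<le> (ent_dist G x\<^sub>0 y + ent_dist G y x) + word_norm_from G x\<^sub>0 xs
          + (word_norm_from G x\<^sub>0 ys + word_norm_from G x\<^sub>0 ys)"
        by (rule add_increasing2) auto
      finally show ?thesis using v False by (simp add: sym_word_norm add_ac)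
    qed
  qed
qed simp

lemma free_dist_le: "free_dist G x\<^sub>0 u v \<le> word_norm_from G x\<^sub>0 u + word_norm_from G x\<^sub>0 v"
proof (induction u arbitrary: v)
  case Nil
  then show ?case by (simp add: free_dist_Nil)
next
  case (Cons x xs)
  show ?case
  proof (cases v)
    case Nil
    then show ?thesis by (simp add: sym_ent_dist)
  next
    case v: (Cons y ys)
    show ?thesis
    proof (cases "x = y")
      case True
      have "free_dist G x\<^sub>0 xs ys \<le> word_norm_from G x\<^sub>0 xs + word_norm_from G x\<^sub>0 ys
          + (ent_dist G x\<^sub>0 x + ent_dist G x\<^sub>0 y)"
        by (rule add_increasing2) (use Cons in auto)
      then show ?thesis using True v by (simp add: add_ac)
    next
      case False
      have "ent_dist G x y + word_norm_from G x\<^sub>0 xs + word_norm_from G x\<^sub>0 ys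
        \<le> (ent_dist G x x\<^sub>0 + ent_dist G x\<^sub>0 y) + word_norm_from G x\<^sub>0 xs + word_norm_from G x\<^sub>0 ys"
        by (intro add_mono ent_dist_triangle order_refl)
      then show ?thesis
        using False v by (simp add: sym_word_norm sym_ent_dist[of x x\<^sub>0] add_ac)
    qed
  qed
qed

lemma free_dist_triangle: "free_dist G x\<^sub>0 u w \<le> free_dist G x\<^sub>0 u v + free_dist G x\<^sub>0 v w"
proof (induction u arbitrary: v w)
  case Nil
  then show ?case using word_norm_le[of w v] by (simp add: free_dist_Nil)
next
  case (Cons x xs)
  consider "v = []" | "w = []" | y ys z zs where "v = y # ys" "w = z # zs"
    by (cases v; cases w) auto
  then show ?case
  proof cases
    case 1
    then show ?thesis
      using free_dist_le[of "x # xs" w] by (simp add: free_dist_Nil sym_ent_dist[of x x\<^sub>0])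
  next
    case 2
    then show ?thesis
      using word_norm_le[of "x # xs" v]
      by (simp only: sym_free_dist[of _ "[]"] free_dist_Nil sym_free_dist[of "x # xs" v])
        (simp add: add.commute)
  next
    case 3
    let ?d = "ent_dist G" and ?N = "word_norm_from G x\<^sub>0"
    consider "x = y" "y = z" | "x = y" "y \<noteq> z" | "x \<noteq> y" "y = z" | "x \<noteq> y" "x = z"
      | "x \<noteq> y" "y \<noteq> z" "x \<noteq> z" by blast
    then show ?thesis
    proof cases
      case 1
      then show ?thesis using 3 Cons by simp
    next
      case 2
      have "?d x z + ?N xs + ?N zs \<le> ?d x z + (?N ys + free_dist G x\<^sub>0 ys xs) + ?N zs"
        by (intro add_mono word_norm_le order_refl)
      then show ?thesis
        using 2 3 by (simp add: sym_word_norm sym_free_dist[of xs ys] add_ac)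
    next
      case c: 3
      have "?d x z + ?N xs + ?N zs \<le> ?d x z + ?N xs + (?N ys + free_dist G x\<^sub>0 ys zs)"
        by (intro add_mono word_norm_le order_refl)
      then show ?thesis
        using c 3 by (simp add: sym_word_norm add_ac)
    next
      case 4
      have "free_dist G x\<^sub>0 xs zs \<le> (?N xs + ?N zs) + (?d x y + ?N ys + (?d y z + ?N ys))"
        by (rule add_increasing2) (use free_dist_le in auto)
      then show ?thesis
        using 4 3 by (auto simp: sym_word_norm add_ac)
    next
      case 5
      have "?d x z + ?N xs + ?N zs \<le> (?d x y + ?d y z) + ?N xs + ?N zs"
        by (intro add_mono ent_dist_triangle order_refl)
      also have "\<dots> \<le> ((?d x y + ?d y z) + ?N xs + ?N zs) + (?N ys + ?N ys)"
        by (rule add_increasing2) auto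
      finally show ?thesis
        using 5 3 by (simp add: sym_word_norm add_ac)
    qed
  qed
qed

end

lemma free_ball_mono: "E \<subseteq> F \<Longrightarrow> m \<le> n \<Longrightarrow> free_ball X x\<^sub>0 E m \<subseteq> free_ball X x\<^sub>0 F n"
  unfolding free_ball_def
  by clarsimp (meson enat_ord_simps(1) free_dist_mono order_trans)

theorem coarse_space_free_coarse:
  assumes "coarse_space X \<E>"
  shows "coarse_space (free_words X x\<^sub>0) (free_coarse X \<E> x\<^sub>0)"
proof -
  interpret coarse_space X \<E> by fact
  show ?thesis
  proof
    fix A assume "A \<in> free_coarse X \<E> x\<^sub>0"
    then show "A \<subseteq> free_words X x\<^sub>0 \<times> free_words X x\<^sub>0"
      by (auto simp: free_coarse_def free_ball_def)
  next
    have "Id_on (free_words X x\<^sub>0) \<subseteq> free_ball X x\<^sub>0 (Id_on X) 0"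
      by (auto simp: free_ball_def)
    then show "Id_on (free_words X x\<^sub>0) \<in> free_coarse X \<E> x\<^sub>0"
      using diagonal by (auto simp: free_coarse_def)
  next
    fix A assume "A \<in> free_coarse X \<E> x\<^sub>0"
    then obtain E n where E: "E \<in> \<E>" "A \<subseteq> free_ball X x\<^sub>0 E n"
      by (auto simp: free_coarse_def)
    then have "A\<inverse> \<subseteq> free_ball X x\<^sub>0 (E\<inverse>) n"
      by (auto simp: free_ball_def free_dist_converse)
    then show "A\<inverse> \<in> free_coarse X \<E> x\<^sub>0"
      using converse E(1) by (auto simp: free_coarse_def)
  next
    fix A B assume "A \<in> free_coarse X \<E> x\<^sub>0" "B \<in> free_coarse X \<E> x\<^sub>0"
    then obtain E m F n where EF: "E \<in> \<E>" "A \<subseteq> free_ball X x\<^sub>0 E m"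
        "F \<in> \<E>" "B \<subseteq> free_ball X x\<^sub>0 F n"
      by (auto simp: free_coarse_def)
    define G where "G = (E \<union> F) \<union> (E \<union> F)\<inverse>"
    have G: "G \<in> \<E>" unfolding G_def using EF union converse by meson
    have sub: "E \<subseteq> G" "F \<subseteq> G" by (auto simp: G_def)
    have symG: "G\<inverse> = G" by (auto simp: G_def)
    have AB: "A \<subseteq> free_ball X x\<^sub>0 G m" "B \<subseteq> free_ball X x\<^sub>0 G n"
      using EF free_ball_mono[OF sub(1), of m m X x\<^sub>0] free_ball_mono[OF sub(2), of n n X x\<^sub>0] by auto
    have "A \<union> B \<subseteq> free_ball X x\<^sub>0 G (m + n)"
      using AB free_ball_mono[of G G m "m + n" X x\<^sub>0] free_ball_mono[of G G n "m + n" X x\<^sub>0] by auto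
    then show "A \<union> B \<in> free_coarse X \<E> x\<^sub>0"
      using G by (auto simp: free_coarse_def)
    have "A O B \<subseteq> free_ball X x\<^sub>0 G (m + n)"
    proof clarify
      fix u v w assume "(u, v) \<in> A" "(v, w) \<in> B"
      with AB have uv: "u \<in> free_words X x\<^sub>0" "w \<in> free_words X x\<^sub>0"
        "free_dist G x\<^sub>0 u v \<le> enat m" "free_dist G x\<^sub>0 v w \<le> enat n"
        by (auto simp: free_ball_def)
      have "free_dist G x\<^sub>0 u w \<le> enat (m + n)"
        using free_dist_triangle[OF symG, of x\<^sub>0 u w v] add_mono[OF uv(3,4)] by simp
      then show "(u, w) \<in> free_ball X x\<^sub>0 G (m + n)" using uv by (simp add: free_ball_def)
    qed
    then show "A O B \<in> free_coarse X \<E> x\<^sub>0"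
      using G by (auto simp: free_coarse_def)
  next
    fix A B assume "A \<in> free_coarse X \<E> x\<^sub>0" "B \<subseteq> A"
    then show "B \<in> free_coarse X \<E> x\<^sub>0" by (auto simp: free_coarse_def)
  qed
qed

end

theory Submission
  imports Defs
begin

text \<open>Property C of \<open>X\<close>, applied to the balls of radius \<open>n i\<close> for \<open>E i\<close>, yields bounded families
  \<open>\<V> 0, \<dots>, \<V> (m - 1)\<close> covering \<open>X\<close>. Only now is a last scale \<open>(E, n)\<close>, coarser than all those in
  use, fixed. A set of some \<open>\<V> i\<close> is far if it misses the ball of radius \<open>2 n\<close> around \<open>x\<^sub>0\<close>, and
  \<open>N\<close> is the union of the sets that are not far; it is bounded.
  Family \<open>i < m\<close> consists of the sets of words \<open>u y s\<close> with \<open>u\<close> fixed, \<open>y\<close> in a far set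
  \<open>V \<in> \<V> i\<close>, and \<open>s\<close> of norm at most \<open>n\<close>. For different \<open>u\<close> they are more than \<open>n\<close> apart, since
  letters of far sets are too long to be matched by a short \<open>s\<close>.
  The words left over are \<open>p s\<close> with \<open>s\<close> a word over \<open>N\<close>, where \<open>p\<close> is empty, or ends outside \<open>N\<close>
  and \<open>s\<close> has norm greater than \<open>n\<close>. Different \<open>p\<close> are again far apart, and for fixed \<open>p\<close> the
  words over the bounded set \<open>N\<close> form a tree, so that, as for trees, two further families of
  pieces of annuli (of even and of odd index) suffice at the single scale \<open>(E, n)\<close>.\<close>

section \<open>Entourages, letter distances and word norms\<close>

lemma (in coarse_space) finite_UN_entourage:
  assumes "finite I" "\<And>i. i \<in> I \<Longrightarrow> K i \<in> \<E>"
  shows "(\<Union>i\<in>I. K i) \<in> \<E>"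
  using assms
proof (induction I)
  case empty
  show ?case using subset[OF diagonal] by simp
next
  case (insert i I)
  then show ?case by (simp add: union)
qed

lemma (in coarse_space) ent_pow_entourage:
  assumes "E \<in> \<E>"
  shows "ent_pow E k \<in> \<E>"
proof (cases k)
  case 0
  then show ?thesis using subset[OF assms] by (simp add: ent_pow_def)
next
  case (Suc l)
  have "E ^^ Suc l \<in> \<E>"
  proof (induction l)
    case 0
    show ?case using assms by simp
  next
    case (Suc l)
    then show ?case using comp[OF Suc assms] by simp
  qed
  then show ?thesis using Suc by (simp add: ent_pow_def)
qed

lemma one_le_ent_dist:
  assumes "x \<noteq> y"
  shows "1 \<le> ent_dist E x y"
proof -
  have "\<not> ent_dist E x y \<le> enat 0"
    using assms by (auto simp: ent_dist_le_iff ent_pow_def)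
  then show ?thesis by (simp add: ileI1 one_eSuc zero_enat_def)
qed

lemma ent_dist_le_one: "(x, y) \<in> E \<Longrightarrow> ent_dist E x y \<le> 1"
  using ent_dist_le_iff[of E x y 1] by (auto simp: ent_pow_def one_enat_def intro!: exI[of _ 1])

lemma word_norm_from_append:
  "word_norm_from E x\<^sub>0 (u @ v) = word_norm_from E x\<^sub>0 u + word_norm_from E x\<^sub>0 v"
  by (simp add: word_norm_from_def)

lemma length_le_word_norm_from:
  assumes "x\<^sub>0 \<notin> set w"
  shows "enat (length w) \<le> word_norm_from E x\<^sub>0 w"
  using assms
proof (induction w)
  case (Cons x w)
  then have "1 + enat (length w) \<le> ent_dist E x\<^sub>0 x + word_norm_from E x\<^sub>0 w"
    by (intro add_mono one_le_ent_dist) auto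
  then show ?case by (simp add: one_enat_def)
qed (simp add: zero_enat_def)

lemma word_norm_from_le_length:
  assumes "\<And>x. x \<in> set w \<Longrightarrow> ent_dist E x\<^sub>0 x \<le> enat c"
  shows "word_norm_from E x\<^sub>0 w \<le> enat (length w * c)"
  using assms
proof (induction w)
  case (Cons x w)
  then have "ent_dist E x\<^sub>0 x + word_norm_from E x\<^sub>0 w \<le> enat c + enat (length w * c)"
    by (intro add_mono) auto
  then show ?case by simp
qed (simp add: zero_enat_def)

lemma free_dist_append: "free_dist E x\<^sub>0 (p @ s) (p @ s') = free_dist E x\<^sub>0 s s'"
  by (induction p) auto

text \<open>The common prefix of the two words is then shorter than \<open>u\<close>, so
  \<open>v\<close> lies behind the differing letter and contributes its full norm.\<close>

lemma word_norm_from_le_free_dist: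
  assumes "\<not> prefix u w"
  shows "word_norm_from E x\<^sub>0 v \<le> free_dist E x\<^sub>0 (u @ v) w"
  using assms
proof (induction u arbitrary: w)
  case (Cons x u)
  show ?case
  proof (cases w)
    case Nil
    then show ?thesis by (simp add: word_norm_from_append add_increasing)
  next
    case (Cons y ys)
    then show ?thesis using Cons.IH[of ys] Cons.prems
      by (auto simp: word_norm_from_append add_increasing add_increasing2)
  qed
qed simp

section \<open>The two kinds of pieces\<close>

definition far_piece :: "'a set \<Rightarrow> 'a \<Rightarrow> ('a \<times> 'a) set \<Rightarrow> nat \<Rightarrow> 'a list \<Rightarrow> 'a set \<Rightarrow> 'a list set" where
  "far_piece X x\<^sub>0 E n u V =
     {w \<in> free_words X x\<^sub>0. \<exists>y s. w = u @ y # s \<and> y \<in> V \<and> word_norm_from E x\<^sub>0 s \<le> enat n}"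

text \<open>As in the usual covers of a tree, annuli of width \<open>Suc n\<close> are cut according
  to the initial segment \<open>q\<close> ending one width further in. Length stands in for the
  norm, to which it is comparable over a bounded \<open>N\<close>. Truncated subtraction makes
  \<open>q\<close> empty for \<open>k = 0\<close> as well as for \<open>k = 1\<close>.\<close>

definition annulus_piece ::
    "'a set \<Rightarrow> 'a \<Rightarrow> ('a \<times> 'a) set \<Rightarrow> nat \<Rightarrow> 'a set \<Rightarrow> nat \<Rightarrow> 'a list \<Rightarrow> 'a list \<Rightarrow> 'a list set" where
  "annulus_piece X x\<^sub>0 E n N k p q =
     {w \<in> free_words X x\<^sub>0. \<exists>s. w = p @ s \<and> set s \<subseteq> N \<and>
        (p = [] \<or> last p \<notin> N \<and> enat n < word_norm_from E x\<^sub>0 s) \<and>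
        length s div Suc n = k \<and> take ((k - 1) * Suc n) s = q}"

section \<open>Separation and boundedness of far pieces\<close>

text \<open>Behind \<open>u'\<close> only an end of \<open>s\<close>, of norm at most
  \<open>n\<close>, is left of \<open>w\<close>, while \<open>w'\<close> goes on with a letter of
  norm greater than \<open>2 * n\<close>. The triangle inequality leaves more than \<open>n\<close>
  for the distance.\<close>

lemma free_dist_far_piece_prefix:
  assumes sym: "E\<inverse> = E"
    and far: "\<And>z. z \<in> V' \<Longrightarrow> enat (2 * n) < ent_dist E x\<^sub>0 z"
    and w: "w \<in> far_piece X x\<^sub>0 E n u V" and w': "w' \<in> far_piece X x\<^sub>0 E n u' V'"
    and u: "strict_prefix u u'" and pre: "prefix u' w"
  shows "enat n < free_dist E x\<^sub>0 w w'"
proof -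
  obtain y s where ys: "w = u @ y # s" "word_norm_from E x\<^sub>0 s \<le> enat n"
    using w by (auto simp: far_piece_def)
  obtain y' s' where ys': "w' = u' @ y' # s'" "y' \<in> V'"
    using w' by (auto simp: far_piece_def)
  obtain z t where "u' = u @ z # t"
    using u by (auto elim: strict_prefixE')
  \<comment> \<open>As \<open>u'\<close> is a prefix of \<open>w\<close>, the letter
    \<open>z\<close> is \<open>y\<close> and \<open>t\<close> begins \<open>s\<close>.\<close>
  then obtain s'' where u': "u' = u @ y # t" "s = t @ s''"
    using pre ys(1) by (auto simp: prefix_def)
  let ?N = "word_norm_from E x\<^sub>0" and ?d = "free_dist E x\<^sub>0 s'' (y' # s')"
  have "w = u' @ s''"
    using ys(1) u' by simp
  then have d: "free_dist E x\<^sub>0 w w' = ?d"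
    using ys'(1) by (simp only: free_dist_append)
  have "enat (2 * n) < ?N (y' # s')"
    using far[OF ys'(2)] by (auto intro: less_le_trans)
  also have "\<dots> \<le> ?N s'' + ?d"
    by (rule word_norm_le[OF sym])
  also have "\<dots> \<le> enat n + ?d"
  proof (rule add_right_mono)
    have "?N s'' \<le> ?N s"
      by (simp add: u'(2) word_norm_from_append add_increasing)
    then show "?N s'' \<le> enat n" using ys(2) by simp
  qed
  finally show ?thesis unfolding d by (cases ?d) auto
qed

text \<open>If one of \<open>u\<close>, \<open>u'\<close> is not a prefix of the other word, the far
  letter behind it counts in full. Otherwise both are prefixes of \<open>w\<close>, hence
  comparable, and the nested case applies.\<close>

lemma free_dist_far_piece:
  assumes sym: "E\<inverse> = E"
    and V: "\<And>z. z \<in> V \<Longrightarrow> enat (2 * n) < ent_dist E x\<^sub>0 z"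
    and V': "\<And>z. z \<in> V' \<Longrightarrow> enat (2 * n) < ent_dist E x\<^sub>0 z"
    and w: "w \<in> far_piece X x\<^sub>0 E n u V" and w': "w' \<in> far_piece X x\<^sub>0 E n u' V'"
    and "u \<noteq> u'"
  shows "enat n < free_dist E x\<^sub>0 w w'"
proof -
  have not_prefix: "enat n < free_dist E x\<^sub>0 v v'"
    if v: "v \<in> far_piece X x\<^sub>0 E n a A" and A: "\<And>z. z \<in> A \<Longrightarrow> enat (2 * n) < ent_dist E x\<^sub>0 z"
      and np: "\<not> prefix a v'" for v v' a A
  proof -
    obtain y s where ys: "v = a @ y # s" "y \<in> A"
      using v by (auto simp: far_piece_def)
    have "enat n \<le> enat (2 * n)" by simp
    also have "\<dots> < ent_dist E x\<^sub>0 y" using A ys(2) .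
    also have "\<dots> \<le> word_norm_from E x\<^sub>0 (y # s)" by simp
    also have "\<dots> \<le> free_dist E x\<^sub>0 v v'"
      unfolding ys(1) by (rule word_norm_from_le_free_dist[OF np])
    finally show ?thesis .
  qed
  consider "\<not> prefix u w'" | "\<not> prefix u' w" | "prefix u w'" "prefix u' w" by blast
  then show ?thesis
  proof cases
    case 1
    then show ?thesis using not_prefix[OF w V] by blast
  next
    case 2
    then show ?thesis using not_prefix[OF w' V'] sym_free_dist[OF sym, of x\<^sub>0 w w'] by simp
  next
    case 3
    have "prefix u w" using w by (auto simp: far_piece_def)
    then consider "strict_prefix u u'" | "strict_prefix u' u"
      using 3(2) \<open>u \<noteq> u'\<close> prefix_same_cases by (metis strict_prefixI)
    then show ?thesis
    proof cases
      case 1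
      then show ?thesis using free_dist_far_piece_prefix[OF sym V' w w'] 3 by blast
    next
      case 2
      then show ?thesis
        using free_dist_far_piece_prefix[OF sym V w' w] 3 sym_free_dist[OF sym, of x\<^sub>0 w w'] by simp
    qed
  qed
qed

text \<open>The letters right after \<open>u\<close> differ, so their distance is a lower bound.
  \<open>F\<close> and \<open>c\<close> are independent of the scale of the pieces, since the sets
  of family \<open>i\<close> are only separated at scale \<open>i\<close>.\<close>

lemma free_dist_far_piece_same:
  assumes "w \<in> far_piece X x\<^sub>0 E n u V" and "w' \<in> far_piece X x\<^sub>0 E n u V'"
    and "V \<inter> V' = {}" and "\<And>y y'. y \<in> V \<Longrightarrow> y' \<in> V' \<Longrightarrow> c < ent_dist F y y'"
  shows "c < free_dist F x\<^sub>0 w w'"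
proof -
  obtain y s where ys: "w = u @ y # s" "y \<in> V" using assms(1) by (auto simp: far_piece_def)
  obtain y' s' where ys': "w' = u @ y' # s'" "y' \<in> V'" using assms(2) by (auto simp: far_piece_def)
  have "y \<noteq> y'" using ys(2) ys'(2) assms(3) by auto
  then have "ent_dist F y y' \<le> free_dist F x\<^sub>0 w w'"
    unfolding ys(1) ys'(1) free_dist_append by (simp add: add.assoc)
  then show ?thesis using assms(4)[OF ys(2) ys'(2)] by simp
qed

text \<open>The stem \<open>u\<close> cancels, the letters cost at most \<open>1\<close> and the
  tails at most \<open>n\<close> each. The bound depends on neither \<open>u\<close> nor
  \<open>V\<close>, so it serves a whole family.\<close>

lemma far_piece_bounded:
  assumes sym: "G\<inverse> = G" and "E \<subseteq> G" and "V \<times> V \<subseteq> G"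
  shows "far_piece X x\<^sub>0 E n u V \<times> far_piece X x\<^sub>0 E n u V \<subseteq> free_ball X x\<^sub>0 G (1 + n + n)"
proof clarify
  fix w w' assume w: "w \<in> far_piece X x\<^sub>0 E n u V" "w' \<in> far_piece X x\<^sub>0 E n u V"
  obtain y s where ys: "w = u @ y # s" "y \<in> V" "word_norm_from E x\<^sub>0 s \<le> enat n"
    using w(1) by (auto simp: far_piece_def)
  obtain y' s' where ys': "w' = u @ y' # s'" "y' \<in> V" "word_norm_from E x\<^sub>0 s' \<le> enat n"
    using w(2) by (auto simp: far_piece_def)
  let ?N = "word_norm_from G x\<^sub>0"
  have N: "?N s \<le> enat n" "?N s' \<le> enat n"
    using word_norm_mono(1)[OF assms(2)] ys(3) ys'(3) by (meson order_trans)+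
  have "free_dist G x\<^sub>0 w w' \<le> 1 + ?N s + ?N s'"
  proof (cases "y = y'")
    case True
    have "free_dist G x\<^sub>0 s s' \<le> ?N s + ?N s'"
      by (rule free_dist_le[OF sym])
    also have "\<dots> \<le> 1 + (?N s + ?N s')" by (rule add_increasing) auto
    finally show ?thesis
      using True unfolding ys(1) ys'(1) free_dist_append by (simp add: add.assoc)
  next
    case False
    have "ent_dist G y y' \<le> 1"
      by (rule ent_dist_le_one) (use assms(3) ys(2) ys'(2) in auto)
    then show ?thesis
      using False unfolding ys(1) ys'(1) free_dist_append
      by (simp add: sym_word_norm[OF sym] add_right_mono)
  qed
  also have "\<dots> \<le> 1 + enat n + enat n"
    using N by (intro add_mono) auto
  finally show "(w, w') \<in> free_ball X x\<^sub>0 G (1 + n + n)"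
    using w by (auto simp: free_ball_def far_piece_def one_enat_def)
qed

section \<open>Separation and boundedness of annulus pieces\<close>

text \<open>As \<open>k\<close> is the larger index, \<open>s'\<close> does not begin with
  \<open>q\<close>, and at least \<open>Suc n\<close> letters of \<open>s\<close> follow
  \<open>q\<close>, each of norm at least one.\<close>

lemma free_dist_annulus_piece_le:
  assumes w: "w \<in> annulus_piece X x\<^sub>0 E n N k p q" and w': "w' \<in> annulus_piece X x\<^sub>0 E n N k' p q'"
    and parity: "k mod 2 = k' mod 2" and ne: "(k, q) \<noteq> (k', q')" and "k' \<le> k"
  shows "enat n < free_dist E x\<^sub>0 w w'"
proof -
  obtain s where s: "w = p @ s" "length s div Suc n = k" "take ((k - 1) * Suc n) s = q"
    "w \<in> free_words X x\<^sub>0"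
    using w by (auto simp: annulus_piece_def)
  obtain s' where s': "w' = p @ s'" "length s' div Suc n = k'" "take ((k' - 1) * Suc n) s' = q'"
    using w' by (auto simp: annulus_piece_def)
  have k: "k * Suc n \<le> length s"
    using div_times_less_eq_dividend[of "length s" "Suc n"] s(2) by simp
  have q: "length q = (k - 1) * Suc n"
  proof -
    have "(k - 1) * Suc n \<le> k * Suc n" by (intro mult_right_mono) auto
    then show ?thesis using s(3) k by auto
  qed
  have np: "\<not> prefix q s'" and k1: "1 \<le> k"
  proof -
    have "\<not> prefix q s' \<and> 1 \<le> k"
    proof (cases "k = k'")
      case True
      then have "q \<noteq> q'" using ne by simp
      \<comment> \<open>For \<open>k = 0\<close> both segments would be empty, against
        \<open>q \<noteq> q'\<close>.\<close>
      then show ?thesis using True q s(3) s'(3) by (cases k) (auto simp: prefix_def)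
    next
      case False
      \<comment> \<open>Equal parity leaves a whole annulus in between, which makes
        \<open>s'\<close> shorter than \<open>q\<close>.\<close>
      then have "k' + 2 \<le> k" using \<open>k' \<le> k\<close> parity by presburger
      then have "(k' + 1) * Suc n \<le> (k - 1) * Suc n" by (intro mult_right_mono) auto
      moreover have "length s' < (k' + 1) * Suc n"
        using s'(2) dividend_less_times_div[of "Suc n" "length s'"] by (simp add: algebra_simps)
      ultimately have "length s' < length q" using q by linarith
      then show ?thesis using prefix_length_le \<open>k' + 2 \<le> k\<close> by fastforce
    qed
    then show "\<not> prefix q s'" "1 \<le> k" by auto
  qed
  define v where "v = drop ((k - 1) * Suc n) s"
  have sqv: "s = q @ v" by (simp add: v_def s(3)[symmetric])
  have "(k - 1) * Suc n + Suc n = k * Suc n" using k1 by (cases k) auto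
  then have "Suc n \<le> length v" using k by (simp add: v_def)
  then have "enat n < enat (length v)" by simp
  also have "\<dots> \<le> word_norm_from E x\<^sub>0 v"
    using s(1,4) sqv by (intro length_le_word_norm_from) (auto simp: free_words_def)
  also have "\<dots> \<le> free_dist E x\<^sub>0 s s'"
    unfolding sqv by (rule word_norm_from_le_free_dist[OF np])
  also have "\<dots> = free_dist E x\<^sub>0 w w'"
    by (simp add: s(1) s'(1) free_dist_append)
  finally show ?thesis .
qed

text \<open>Equal stems reduce to the previous lemma by symmetry. For different stems, one that is
  not a prefix of the other word is nonempty, so its remainder of norm greater than \<open>n\<close>
  counts in full. Both cannot be prefixes: the longer stem ends outside \<open>N\<close>, yet all
  letters behind the shorter one lie in \<open>N\<close>.\<close>

lemma free_dist_annulus_piece: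
  assumes sym: "E\<inverse> = E"
    and w: "w \<in> annulus_piece X x\<^sub>0 E n N k p q" and w': "w' \<in> annulus_piece X x\<^sub>0 E n N k' p' q'"
    and parity: "k mod 2 = k' mod 2" and ne: "(k, p, q) \<noteq> (k', p', q')"
  shows "enat n < free_dist E x\<^sub>0 w w'"
proof (cases "p = p'")
  case True
  show ?thesis
  proof (cases "k' \<le> k")
    case le: True
    then show ?thesis using free_dist_annulus_piece_le[of w X x\<^sub>0 E n N k p q w' k' q'] assms True by auto
  next
    case False
    then show ?thesis
      using free_dist_annulus_piece_le[of w' X x\<^sub>0 E n N k' p' q' w k q] assms True
        sym_free_dist[OF sym, of x\<^sub>0 w w'] by auto
  qed
next
  case False
  have not_prefix: "enat n < free_dist E x\<^sub>0 v v'"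
    if v: "v \<in> annulus_piece X x\<^sub>0 E n N l a b" and np: "\<not> prefix a v'" for v v' l a b
  proof -
    obtain s where s: "v = a @ s" "enat n < word_norm_from E x\<^sub>0 s"
      using v np by (auto simp: annulus_piece_def)
    then show ?thesis using word_norm_from_le_free_dist[OF np] by (metis less_le_trans)
  qed
  have absurd: False
    if v: "v \<in> annulus_piece X x\<^sub>0 E n N l a b" and v': "v' \<in> annulus_piece X x\<^sub>0 E n N l' a' b'"
      and pre: "prefix a' v" "strict_prefix a a'" for v v' l l' a a' b b'
  proof -
    obtain z t where a': "a' = a @ z # t"
      using pre(2) by (auto elim: strict_prefixE')
    have "set (z # t) \<subseteq> N"
      using v pre(1) by (auto simp: annulus_piece_def a' prefix_def)
    moreover have "last a' \<notin> N" using v' a' by (auto simp: annulus_piece_def)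
    moreover have "last a' \<in> set (z # t)"
      using last_in_set[of "z # t"] by (simp only: a' last_appendR list.distinct not_False_eq_True)
    ultimately show False by (meson subsetD)
  qed
  consider "\<not> prefix p w'" | "\<not> prefix p' w" | "prefix p w'" "prefix p' w" by blast
  then show ?thesis
  proof cases
    case 1
    then show ?thesis using not_prefix[OF w] by blast
  next
    case 2
    then show ?thesis using not_prefix[OF w'] sym_free_dist[OF sym, of x\<^sub>0 w w'] by simp
  next
    case 3
    have "prefix p w" using w by (auto simp: annulus_piece_def)
    then consider "strict_prefix p p'" | "strict_prefix p' p"
      using 3(2) \<open>p \<noteq> p'\<close> prefix_same_cases by (metis strict_prefixI)
    then show ?thesis using absurd[OF w w'] absurd[OF w' w] 3 by cases auto
  qed
qed

text \<open>Words of one piece share \<open>p @ q\<close>, and at most \<open>2 * Suc n\<close>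
  letters follow, each of norm at most \<open>c\<close>.\<close>

lemma annulus_piece_bounded:
  assumes sym: "G\<inverse> = G" and N: "\<And>x. x \<in> N \<Longrightarrow> ent_dist G x\<^sub>0 x \<le> enat c"
  shows "annulus_piece X x\<^sub>0 E n N k p q \<times> annulus_piece X x\<^sub>0 E n N k p q
    \<subseteq> free_ball X x\<^sub>0 G (2 * Suc n * c + 2 * Suc n * c)"
proof clarify
  fix w w' assume w: "w \<in> annulus_piece X x\<^sub>0 E n N k p q" "w' \<in> annulus_piece X x\<^sub>0 E n N k p q"
  have rest: "\<exists>v. u = p @ q @ v \<and> word_norm_from G x\<^sub>0 v \<le> enat (2 * Suc n * c)"
    if u: "u \<in> annulus_piece X x\<^sub>0 E n N k p q" for u
  proof -
    obtain s where s: "u = p @ s" "set s \<subseteq> N" "length s div Suc n = k" "take ((k - 1) * Suc n) s = q"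
      using u by (auto simp: annulus_piece_def)
    define v where "v = drop ((k - 1) * Suc n) s"
    have sqv: "s = q @ v" by (simp add: v_def s(4)[symmetric])
    have "length s < (k + 1) * Suc n"
      using s(3) dividend_less_times_div[of "Suc n" "length s"] by (simp add: algebra_simps)
    moreover have "(k + 1) * Suc n \<le> (k - 1) * Suc n + 2 * Suc n"
      by (cases k) auto
    ultimately have "length v \<le> 2 * Suc n" unfolding v_def length_drop by linarith
    then have "enat (length v * c) \<le> enat (2 * Suc n * c)"
      by (simp only: enat_ord_simps mult_le_mono1)
    moreover have "word_norm_from G x\<^sub>0 v \<le> enat (length v * c)"
      using s(2) sqv N by (intro word_norm_from_le_length) auto
    ultimately have "word_norm_from G x\<^sub>0 v \<le> enat (2 * Suc n * c)" by (meson order_trans)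
    then show ?thesis using s(1) sqv by blast
  qed
  obtain v v' where v: "w = p @ q @ v" "word_norm_from G x\<^sub>0 v \<le> enat (2 * Suc n * c)"
    "w' = p @ q @ v'" "word_norm_from G x\<^sub>0 v' \<le> enat (2 * Suc n * c)"
    using rest[OF w(1)] rest[OF w(2)] by blast
  have "free_dist G x\<^sub>0 w w' = free_dist G x\<^sub>0 v v'"
    by (simp add: v free_dist_append)
  also have "\<dots> \<le> word_norm_from G x\<^sub>0 v + word_norm_from G x\<^sub>0 v'"
    by (rule free_dist_le[OF sym])
  also have "\<dots> \<le> enat (2 * Suc n * c) + enat (2 * Suc n * c)"
    using v by (intro add_mono) auto
  finally show "(w, w') \<in> free_ball X x\<^sub>0 G (2 * Suc n * c + 2 * Suc n * c)"
    using w by (simp add: free_ball_def annulus_piece_def)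
qed

section \<open>Increasing scales and the final cover\<close>

text \<open>Partial unions and partial sums turn unrelated scales into increasing ones, so that a
  later scale dominates all earlier ones. Symmetry is what the triangle inequality for
  \<open>free_dist\<close> rests on.\<close>

lemma obtain_common_scales:
  assumes "coarse_space X \<E>" and F: "\<And>i. F i \<in> free_coarse X \<E> x\<^sub>0"
  obtains E :: "nat \<Rightarrow> ('a \<times> 'a) set" and n :: "nat \<Rightarrow> nat"
  where "\<And>i. E i \<in> \<E>" "\<And>i. (E i)\<inverse> = E i" "\<And>i. Id_on X \<subseteq> E i" "mono E" "mono n"
    "\<And>i. F i \<subseteq> free_ball X x\<^sub>0 (E i) (n i)"
proof -
  interpret coarse_space X \<E> by fact
  have "\<forall>i. \<exists>E n. E \<in> \<E> \<and> F i \<subseteq> free_ball X x\<^sub>0 E n"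
    using F unfolding free_coarse_def by blast
  then obtain E' n' where E': "\<And>i. E' i \<in> \<E>" "\<And>i. F i \<subseteq> free_ball X x\<^sub>0 (E' i) (n' i)"
    by metis
  define E where "E i = Id_on X \<union> (\<Union>j\<in>{..i}. E' j \<union> (E' j)\<inverse>)" for i
  define n where "n i = (\<Sum>j\<le>i. n' j)" for i :: nat
  show thesis
  proof
    show "E i \<in> \<E>" for i
      unfolding E_def by (intro union diagonal finite_UN_entourage converse E') auto
    show "(E i)\<inverse> = E i" "Id_on X \<subseteq> E i" for i by (auto simp: E_def)
    show "mono E"
      by (rule monoI) (fastforce simp: E_def intro: order_trans)
    show "mono n"
      unfolding n_def by (rule monoI) (auto intro: sum_mono2)
    show "F i \<subseteq> free_ball X x\<^sub>0 (E i) (n i)" for i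
    proof -
      have "E' i \<subseteq> E i" by (auto simp: E_def)
      moreover have "n' i \<le> n i"
        unfolding n_def by (rule member_le_sum) auto
      ultimately show ?thesis using E'(2)[of i] by (meson free_ball_mono order_trans)
    qed
  qed
qed

theorem theorem6p7:
  fixes X :: "'a set" and \<E> :: "('a \<times> 'a) set set" and x\<^sub>0 :: 'a
  assumes "coarse_space X \<E>" and "x\<^sub>0 \<in> X"
    and "coarse_property_C X \<E>"
  shows "coarse_property_C (free_words X x\<^sub>0) (free_coarse X \<E> x\<^sub>0)"
  unfolding coarse_property_C_def
proof (intro allI impI, elim conjE)
  interpret coarse_space X \<E> by fact
  fix F :: "nat \<Rightarrow> ('a list \<times> 'a list) set"
  assume F: "\<forall>i. F i \<in> free_coarse X \<E> x\<^sub>0"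
  obtain E n where E: "\<And>i. E i \<in> \<E>" "\<And>i. (E i)\<inverse> = E i" "\<And>i. Id_on X \<subseteq> E i"
    and mono: "mono E" "mono n" and FE: "\<And>i. F i \<subseteq> free_ball X x\<^sub>0 (E i) (n i)"
    using obtain_common_scales[OF assms(1)] F by metis
  \<comment> \<open>The ball relation of radius \<open>n i\<close> on letters:
    \<open>H i\<close>-disjoint sets have letters more than \<open>n i\<close> apart.\<close>
  define H where "H i = (\<Union>k\<in>{..n i}. ent_pow (E i) k)" for i
  have H_iff: "(x, y) \<in> H i \<longleftrightarrow> ent_dist (E i) x y \<le> enat (n i)" for x y i
    by (auto simp: H_def ent_dist_le_iff)
  have H: "H i \<in> \<E>" for i
    unfolding H_def by (intro finite_UN_entourage ent_pow_entourage E) auto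
  have HS: "H i \<subseteq> H (Suc i)" for i
    unfolding H_def using ent_pow_mono[OF monoD[OF mono(1)], of i "Suc i"] monoD[OF mono(2), of i "Suc i"]
    by fastforce
  obtain m \<V> where V: "\<forall>i<m. \<V> i \<subseteq> Pow X" "\<Union> (\<Union>i<m. \<V> i) = X"
      "\<forall>i<m. coarse_disjoint (H i) (\<V> i)" "\<forall>i<m. coarse_bounded \<E> (\<V> i)"
    using assms(3) H HS unfolding coarse_property_C_def by metis
  obtain K where K: "\<And>i. i < m \<Longrightarrow> K i \<in> \<E>" "\<And>i. i < m \<Longrightarrow> (\<Union>V\<in>\<V> i. V \<times> V) \<subseteq> K i"
    using V(4) unfolding coarse_bounded_def by metis
  \<comment> \<open>There will be \<open>m + 2\<close> families, indexed from \<open>0\<close>, so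
    \<open>Suc m\<close> is the last index.\<close>
  define E\<^sub>1 n\<^sub>1 where "E\<^sub>1 = E (Suc m)" and "n\<^sub>1 = n (Suc m)"
  have sym: "E\<^sub>1\<inverse> = E\<^sub>1" by (simp add: E\<^sub>1_def E)
  \<comment> \<open>One symmetric entourage for all bounds, containing the last scale and every
    \<open>V \<times> V\<close>.\<close>
  define G where "G = E\<^sub>1 \<union> ((\<Union>i\<in>{..<m}. K i) \<union> (\<Union>i\<in>{..<m}. K i)\<inverse>)"
  have G: "G \<in> \<E>"
    unfolding G_def E\<^sub>1_def by (intro union converse finite_UN_entourage E K) auto
  have symG: "G\<inverse> = G" using sym by (auto simp: G_def)
  have EG: "E\<^sub>1 \<subseteq> G" by (simp add: G_def)
  have VG: "V \<times> V \<subseteq> G" if "i < m" "V \<in> \<V> i" for i V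
    using K(2)[OF that(1)] that by (fastforce simp: G_def)
  define far where "far V \<longleftrightarrow> (\<forall>z\<in>V. enat (2 * n\<^sub>1) < ent_dist E\<^sub>1 x\<^sub>0 z)" for V
  define N where "N = \<Union> {V \<in> (\<Union>i<m. \<V> i). \<not> far V}"
  \<comment> \<open>A set that is not far has a point \<open>z\<close> of norm at most
    \<open>2 * n\<^sub>1\<close>, and \<open>z\<close> is within one \<open>G\<close>-step of all
    its points.\<close>
  have NG: "ent_dist G x\<^sub>0 x \<le> enat (2 * n\<^sub>1 + 1)" if x: "x \<in> N" for x
  proof -
    obtain i V z where iV: "i < m" "V \<in> \<V> i" "x \<in> V" "z \<in> V" "ent_dist E\<^sub>1 x\<^sub>0 z \<le> enat (2 * n\<^sub>1)"
      using x by (auto simp: N_def far_def not_less)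
    have "ent_dist G x\<^sub>0 x \<le> ent_dist G x\<^sub>0 z + ent_dist G z x"
      by (rule ent_dist_triangle)
    also have "\<dots> \<le> enat (2 * n\<^sub>1) + 1"
    proof (rule add_mono)
      show "ent_dist G x\<^sub>0 z \<le> enat (2 * n\<^sub>1)"
        using ent_dist_mono[OF EG, of x\<^sub>0 z] iV(5) by (rule order_trans)
      show "ent_dist G z x \<le> 1"
        by (rule ent_dist_le_one) (use VG[OF iV(1,2)] iV in auto)
    qed
    finally show ?thesis by (simp add: one_enat_def)
  qed
  \<comment> \<open>Index \<open>m\<close> receives the even annuli and index \<open>m + 1\<close>
    the odd ones.\<close>
  define \<U> where "\<U> i = (if i < m then {far_piece X x\<^sub>0 E\<^sub>1 n\<^sub>1 u V | u V. V \<in> \<V> i \<and> far V}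
     else {annulus_piece X x\<^sub>0 E\<^sub>1 n\<^sub>1 N k p q | k p q. k mod 2 = i - m})" for i
  have sub: "\<U> i \<subseteq> Pow (free_words X x\<^sub>0)" for i
    by (auto simp: \<U>_def far_piece_def annulus_piece_def split: if_splits)
  have "w \<in> \<Union> (\<Union>i<m + 2. \<U> i)" if w: "w \<in> free_words X x\<^sub>0" for w
  proof -
    \<comment> \<open>\<open>s\<close> is the longest suffix over \<open>N\<close>. If
      \<open>p\<close> is nonempty, its last letter is outside \<open>N\<close>, so any set of the
      cover containing that letter is far.\<close>
    define p where "p = rev (dropWhile (\<lambda>x. x \<in> N) (rev w))"
    define s where "s = rev (takeWhile (\<lambda>x. x \<in> N) (rev w))"
    have ps: "w = p @ s"
      unfolding p_def s_def by (metis rev_append rev_rev_ident takeWhile_dropWhile_id)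
    have sN: "set s \<subseteq> N" by (auto simp: s_def dest: set_takeWhileD)
    have last: "last p \<notin> N" if "p \<noteq> []"
      using that hd_dropWhile[of "\<lambda>x. x \<in> N" "rev w"] by (simp add: p_def last_rev)
    show ?thesis
    proof (cases "p = [] \<or> enat n\<^sub>1 < word_norm_from E\<^sub>1 x\<^sub>0 s")
      case True
      define k where "k = length s div Suc n\<^sub>1"
      have "w \<in> annulus_piece X x\<^sub>0 E\<^sub>1 n\<^sub>1 N k p (take ((k - 1) * Suc n\<^sub>1) s)"
        using True w ps sN last by (auto simp: annulus_piece_def k_def)
      moreover have "annulus_piece X x\<^sub>0 E\<^sub>1 n\<^sub>1 N k p (take ((k - 1) * Suc n\<^sub>1) s) \<in> \<U> (m + k mod 2)"
        by (auto simp: \<U>_def)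
      ultimately show ?thesis by fastforce
    next
      case False
      then have wp: "w = butlast p @ last p # s" using ps by simp
      then have "last p \<in> X" using w by (auto simp: free_words_def)
      then obtain i V where iV: "i < m" "V \<in> \<V> i" "last p \<in> V" using V(2) by blast
      then have "far V" using last False by (auto simp: N_def)
      moreover have "w \<in> far_piece X x\<^sub>0 E\<^sub>1 n\<^sub>1 (butlast p) V"
        using w wp iV False by (auto simp: far_piece_def not_less)
      ultimately have "w \<in> \<Union> (\<U> i)" using iV by (auto simp: \<U>_def)
      then show ?thesis using iV(1) by force
    qed
  qed
  then have cover: "\<Union> (\<Union>i<m + 2. \<U> i) = free_words X x\<^sub>0" using sub by blast
  have disj: "coarse_disjoint (F i) (\<U> i)" if i: "i < m + 2" for i
  proof -
    have scale: "E i \<subseteq> E\<^sub>1" "n i \<le> n\<^sub>1"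
      using i monoD[OF mono(1), of i "Suc m"] monoD[OF mono(2), of i "Suc m"]
      by (auto simp: E\<^sub>1_def n\<^sub>1_def)
    \<comment> \<open>Distances grow as the entourage shrinks, so separation at the last scale
      passes to scale \<open>i\<close>.\<close>
    have *: "enat (n i) < free_dist (E i) x\<^sub>0 w w'" if "enat n\<^sub>1 < free_dist E\<^sub>1 x\<^sub>0 w w'" for w w'
    proof -
      have "enat (n i) \<le> enat n\<^sub>1" using scale by simp
      also have "\<dots> < free_dist E\<^sub>1 x\<^sub>0 w w'" by fact
      also have "\<dots> \<le> free_dist (E i) x\<^sub>0 w w'" by (rule free_dist_mono[OF scale(1)])
      finally show ?thesis .
    qed
    have "enat (n i) < free_dist (E i) x\<^sub>0 w w'"
      if AB: "A \<in> \<U> i" "B \<in> \<U> i" "A \<noteq> B" and w: "w \<in> A" "w' \<in> B" for A B w w'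
    proof (cases "i < m")
      case True
      obtain u V u' V' where A: "A = far_piece X x\<^sub>0 E\<^sub>1 n\<^sub>1 u V" "V \<in> \<V> i" "far V"
        and B: "B = far_piece X x\<^sub>0 E\<^sub>1 n\<^sub>1 u' V'" "V' \<in> \<V> i" "far V'"
        using AB True by (auto simp: \<U>_def)
      show ?thesis
      proof (cases "u = u'")
        case False
        then show ?thesis
          using * free_dist_far_piece[OF sym, of V n\<^sub>1 x\<^sub>0 V' w X u w' u'] A B w by (auto simp: far_def)
      next
        case same: True
        then have "V \<noteq> V'" using AB A B by auto
        then have HV: "(V \<times> V') \<inter> H i = {}"
          using V(3) True A(2) B(2) by (auto simp: coarse_disjoint_def)
        \<comment> \<open>Exponent \<open>0\<close> gives only \<open>E i \<inter> Id\<close>, hence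
          the diagonal of \<open>X\<close> was put into \<open>E i\<close>. It follows that
          \<open>H i\<close>-disjoint sets do not meet.\<close>
        have "(y, y) \<in> H i" if "y \<in> V" for y
        proof -
          have "y \<in> X" using V(1) True A(2) that by blast
          then have "(y, y) \<in> ent_pow (E i) 0" using E(3)[of i] by (auto simp: ent_pow_def)
          then show ?thesis by (auto simp: H_def)
        qed
        then have "V \<inter> V' = {}" using HV by blast
        moreover have "enat (n i) < ent_dist (E i) y y'" if "y \<in> V" "y' \<in> V'" for y y'
          using HV that H_iff[of y y' i] by (auto simp: not_le[symmetric])
        ultimately show ?thesis
          using free_dist_far_piece_same[of w X x\<^sub>0 E\<^sub>1 n\<^sub>1 u V w' V' "enat (n i)" "E i"] A B w same by auto
      qed
    next
      case False
      obtain k p q k' p' q' where "A = annulus_piece X x\<^sub>0 E\<^sub>1 n\<^sub>1 N k p q" "k mod 2 = i - m"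
        "B = annulus_piece X x\<^sub>0 E\<^sub>1 n\<^sub>1 N k' p' q'" "k' mod 2 = i - m"
        using AB(1,2) False unfolding \<U>_def if_not_P[OF False] by blast
      then show ?thesis
        using * free_dist_annulus_piece[OF sym, of w X x\<^sub>0 n\<^sub>1 N k p q w' k' p' q'] AB w by auto
    qed
    then show ?thesis
      using FE[of i] unfolding coarse_disjoint_def free_ball_def not_le[symmetric] by blast
  qed
  have bdd: "coarse_bounded (free_coarse X \<E> x\<^sub>0) (\<U> i)" for i
  proof -
    let ?c = "if i < m then 1 + n\<^sub>1 + n\<^sub>1
      else 2 * Suc n\<^sub>1 * (2 * n\<^sub>1 + 1) + 2 * Suc n\<^sub>1 * (2 * n\<^sub>1 + 1)"
    have "A \<times> A \<subseteq> free_ball X x\<^sub>0 G ?c" if A: "A \<in> \<U> i" for A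
    proof (cases "i < m")
      case True
      then obtain u V where "A = far_piece X x\<^sub>0 E\<^sub>1 n\<^sub>1 u V" "V \<in> \<V> i"
        using A by (auto simp: \<U>_def)
      then show ?thesis
        using True far_piece_bounded[OF symG EG VG] by simp
    next
      case False
      then obtain k p q where A_eq: "A = annulus_piece X x\<^sub>0 E\<^sub>1 n\<^sub>1 N k p q"
        using A by (auto simp: \<U>_def)
      show ?thesis
        unfolding A_eq if_not_P[OF False] by (rule annulus_piece_bounded[OF symG NG])
    qed
    then have "(\<Union>A\<in>\<U> i. A \<times> A) \<subseteq> free_ball X x\<^sub>0 G ?c" by (rule UN_least)
    moreover have "free_ball X x\<^sub>0 G ?c \<in> free_coarse X \<E> x\<^sub>0"
      using G unfolding free_coarse_def by blast
    ultimately show ?thesis unfolding coarse_bounded_def by blast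
  qed
  show "\<exists>k. \<exists>\<U> :: nat \<Rightarrow> 'a list set set.
      (\<forall>i<k. \<U> i \<subseteq> Pow (free_words X x\<^sub>0)) \<and> \<Union> (\<Union>i<k. \<U> i) = free_words X x\<^sub>0 \<and>
      (\<forall>i<k. coarse_disjoint (F i) (\<U> i)) \<and>
      (\<forall>i<k. coarse_bounded (free_coarse X \<E> x\<^sub>0) (\<U> i))"
    by (rule exI[of _ "m + 2"], rule exI[of _ \<U>]) (intro conjI allI impI sub cover disj bdd)
qed

end
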